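(* Let $\ell_n:\mathbb{R}^p\to\mathbb{R}$ be a convex loss (not necessarily differentiable), let $\beta^\star\in\mathbb{R}^p$ be the true parameter with support $\mathcal{A}=\{j:\beta^\star_j\neq 0\}$, let $\lambda>0$, and let $P_\lambda$ be a folded concave penalty with constants $a_1,a_2,a$. Suppose the minimal signal strength satisfies $$\|\beta^\star_{\mathcal{A}}\|_{\min}>(a+1)\lambda .$$ Let $a_0=\min\{1,a_2\}$. Consider the folded concave penalized problem $\min_\beta \ell_n(\beta)+\sum_{j}P_\lambda(|\beta_j|)$. Then under the event $$\mathcal{E}_1=\left\{\|\hat\beta^{\mathrm{initial}}-\beta^\star\|_{\max}\le a_0\lambda\right\}\cap\left\{\|\nabla_{\mathcal{A}^c}\ell_n(\hat\beta^{\mathrm{oracle}})\|_{\max}<a_1\lambda\right\},$$ the LLA algorithm initialized by $\hat\beta^{\mathrm{initial}}$ finds the oracle estimator $\hat\beta^{\mathrm{oracle}}$ after one iteration, i.e. $\hat\beta^{(1)}=\hat\beta^{\mathrm{oracle}}$.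
   Context: Notation: $\|v\|_{\max}=\max_j|v_j|$, $\|v\|_{\min}=\min_j|v_j|$; $v_{\mathcal{A}}$ is the subvector indexed by $\mathcal{A}$. Folded concave penalty: $P_\lambda(|t|)$, $t\in\mathbb{R}$, where, for fixed constants $a_1,a_2>0$ and $a>a_2$: (i) $P_\lambda(t)$ is increasing and concave on $[0,\infty)$ with $P_\lambda(0)=0$; (ii) $P_\lambda$ is differentiable on $(0,\infty)$ with $P'_\lambda(0):=P'_\lambda(0+)\ge a_1\lambda$; (iii) $P'_\lambda(t)\ge a_1\lambda$ for $t\in(0,a_2\lambda]$; (iv) $P'_\lambda(t)=0$ for $t\in[a\lambda,\infty)$. Oracle estimator: $\hat\beta^{\mathrm{oracle}}=(\hat\beta^{\mathrm{oracle}}_{\mathcal{A}},0)=\arg\min_{\beta:\beta_{\mathcal{A}^c}=0}\ell_n(\beta)$. Standing assumption: this minimizer exists and is unique, and $\nabla_j\ell_n(\hat\beta^{\mathrm{oracle}})=0$ for all $j\in\mathcal{A}$. Here $\nabla\ell_n(\hat\beta^{\mathrm{oracle}})=(\nabla_1\ell_n,\ldots,\nabla_p\ell_n)$ denotes a (fixed) subgradient vector of $\ell_n$ at $\hat\beta^{\mathrm{oracle}}$ with this property (the gradient if $\ell_n$ is differentiable), and $\nabla_{\mathcal{A}^c}\ell_n(\hat\beta^{\mathrm{oracle}})$ is its subvector indexed by $\mathcal{A}^c$. LLA (local linear approximation) algorithm: set $\hat\beta^{(0)}=\hat\beta^{\mathrm{initial}}$ (a given vector in $\mathbb{R}^p$);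 for $m=1,2,\ldots$ let $\hat w^{(m-1)}_j=P'_\lambda(|\hat\beta^{(m-1)}_j|)$ and $$\hat\beta^{(m)}=\arg\min_\beta\ \ell_n(\beta)+\sum_j\hat w^{(m-1)}_j|\beta_j| .$$ *)

theory Defs
  imports "HOL-Analysis.Analysis"
begin

definition support :: "real ^ 'p \<Rightarrow> 'p set" where
  "support v = {j. v $ j \<noteq> 0}"

text \<open>
  The index sets below may be empty (for instance when a vector has full or empty support).
  The maximum over the empty set is read as 0 and the minimum as infinity, so that an
  inequality about an empty subvector is vacuous.
\<close>

definition max_norm_on :: "'p::finite set \<Rightarrow> real ^ 'p \<Rightarrow> real" where
  "max_norm_on S v = (if S = {} then 0 else Max ((\<lambda>j. \<bar>v $ j\<bar>) ` S))"

definition min_norm_on :: "'p::finite set \<Rightarrow> real ^ 'p \<Rightarrow> ereal" where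
  "min_norm_on S v = (INF j\<in>S. ereal \<bar>v $ j\<bar>)"

definition is_subgradient :: "(real ^ 'p \<Rightarrow> real) \<Rightarrow> real ^ 'p \<Rightarrow> real ^ 'p \<Rightarrow> bool" where
  "is_subgradient l x g \<longleftrightarrow> (\<forall>y. l y \<ge> l x + g \<bullet> (y - x))"

text \<open>
  The derivative of a penalty on \<open>[0, \<infinity>)\<close>; at 0 it is by convention the right-hand limit
  of the derivative.
\<close>

definition penalty_deriv :: "(real \<Rightarrow> real) \<Rightarrow> real \<Rightarrow> real" where
  "penalty_deriv P t = (if t = 0 then Lim (at_right 0) (deriv P) else deriv P t)"

text \<open>
  \<open>P\<close> stands for the penalty at the fixed level \<open>lam\<close>; only its values on \<open>[0, \<infinity>)\<close> matter.
  ``Increasing'' has to be the non-strict notion, since \<open>P\<close> is flat on \<open>[a lam, \<infinity>)\<close>.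
  The limit is required to exist because \<open>Lim\<close> is otherwise unspecified.
\<close>

definition folded_concave_penalty ::
  "real \<Rightarrow> real \<Rightarrow> real \<Rightarrow> real \<Rightarrow> (real \<Rightarrow> real) \<Rightarrow> bool" where
  "folded_concave_penalty a1 a2 a lam P \<longleftrightarrow>
     a1 > 0 \<and> a2 > 0 \<and> a > a2 \<and>
     mono_on {0..} P \<and> concave_on {0..} P \<and> P 0 = 0 \<and>
     (\<forall>t>0. P differentiable (at t)) \<and>
     (\<exists>L. (deriv P \<longlongrightarrow> L) (at_right 0)) \<and> penalty_deriv P 0 \<ge> a1 * lam \<and>
     (\<forall>t\<in>{0<..a2 * lam}. penalty_deriv P t \<ge> a1 * lam) \<and>
     (\<forall>t\<in>{a * lam..}. penalty_deriv P t = 0)"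

definition is_unique_minimizer :: "('a \<Rightarrow> real) \<Rightarrow> 'a set \<Rightarrow> 'a \<Rightarrow> bool" where
  "is_unique_minimizer f S x \<longleftrightarrow> {y. is_arg_min f (\<lambda>z. z \<in> S) y} = {x}"

definition is_oracle_estimator ::
  "(real ^ 'p \<Rightarrow> real) \<Rightarrow> 'p set \<Rightarrow> real ^ 'p \<Rightarrow> bool" where
  "is_oracle_estimator l A b \<longleftrightarrow> is_unique_minimizer l {\<beta>. \<forall>j\<in>- A. \<beta> $ j = 0} b"

definition lla_objective ::
  "(real ^ 'p \<Rightarrow> real) \<Rightarrow> (real \<Rightarrow> real) \<Rightarrow> real ^ 'p \<Rightarrow> real ^ 'p \<Rightarrow> real" where
  "lla_objective l P b \<beta> = l \<beta> + (\<Sum>j\<in>UNIV. penalty_deriv P \<bar>b $ j\<bar> * \<bar>\<beta> $ j\<bar>)"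

text \<open>
  Minimizers of the weighted problem need not exist or be unique in general, so the algorithm
  is set-valued: \<open>lla_iterates l P b0 m\<close> is the set of all possible values of the m-th iterate
  started from \<open>b0\<close>.
  That this set equals \<open>{b}\<close> says that the m-th iterate exists, is unique and equals \<open>b\<close>.
\<close>

primrec lla_iterates ::
  "(real ^ 'p \<Rightarrow> real) \<Rightarrow> (real \<Rightarrow> real) \<Rightarrow> real ^ 'p \<Rightarrow> nat \<Rightarrow> (real ^ 'p) set" where
  "lla_iterates l P b0 0 = {b0}"
| "lla_iterates l P b0 (Suc m) =
     (\<Union>b\<in>lla_iterates l P b0 m. {\<beta>. is_arg_min (lla_objective l P b) (\<lambda>_. True) \<beta>})"

end

theory Submission imports Defs begin

text \<open>
  The initial estimator is so close to the truth that the weights vanish on the support and are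
  at least \<open>a1 lam\<close> off it. By the subgradient inequality, the weighted objective at
  \<open>\<beta>\<close> then exceeds its value at the restricted minimizer by at least the sum of
  \<open>(w\<^sub>j - \<bar>g\<^sub>j\<bar>) \<bar>\<beta>\<^sub>j\<bar>\<close> off the support, which is positive unless \<open>\<beta>\<close> is supported
  in the true support; there the objective is the loss itself, whose minimizer is unique.
\<close>

lemma abs_nth_le_max_norm_on:
  assumes "j \<in> S"
  shows "\<bar>v $ j\<bar> \<le> max_norm_on S v"
  using assms by (auto simp: max_norm_on_def intro!: Max_ge)

lemma min_norm_on_le_abs_nth:
  assumes "j \<in> S"
  shows "min_norm_on S v \<le> ereal \<bar>v $ j\<bar>"
  unfolding min_norm_on_def using assms by (rule INF_lower)

text \<open>The value 0 needs its own case: the bound there comes from the right-hand limit,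
  elsewhere from the condition on \<open>{0<..a2 * lam}\<close>. Coordinates of the initial
  estimator off the support may be exactly 0.\<close>

lemma penalty_deriv_ge:
  assumes "folded_concave_penalty a1 a2 a lam P" "0 \<le> t" "t \<le> a2 * lam"
  shows "penalty_deriv P t \<ge> a1 * lam"
  using assms by (cases "t = 0") (auto simp: folded_concave_penalty_def)

text \<open>Weights are arbitrary here, so the penalty matters only through \<open>w0\<close> and
  \<open>gw\<close>. The strictness of \<open>gw\<close> rules out further minimizers outside the
  restricted subspace.\<close>

lemma unique_minimizer_weighted_l1:
  fixes l :: "real ^ 'p \<Rightarrow> real"
  assumes restricted: "is_oracle_estimator l A b"
    and subgrad: "is_subgradient l b g"
    and g0: "\<And>j. j \<in> A \<Longrightarrow> g $ j = 0"
    and w0: "\<And>j. j \<in> A \<Longrightarrow> w j = 0"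
    and gw: "\<And>j. j \<notin> A \<Longrightarrow> \<bar>g $ j\<bar> < w j"
  shows "is_unique_minimizer (\<lambda>\<beta>. l \<beta> + (\<Sum>j\<in>UNIV. w j * \<bar>\<beta> $ j\<bar>)) UNIV b"
proof -
  define f where "f = (\<lambda>\<beta>. l \<beta> + (\<Sum>j\<in>UNIV. w j * \<bar>\<beta> $ j\<bar>))"
  define S :: "(real ^ 'p) set" where "S = {\<beta>. \<forall>j\<in>- A. \<beta> $ j = 0}"
  have min: "is_arg_min l (\<lambda>z. z \<in> S) y \<longleftrightarrow> y = b" for y
    using restricted unfolding is_oracle_estimator_def is_unique_minimizer_def S_def by blast
  have bS: "b \<in> S"
    using min[of b] by (simp add: is_arg_min_def)
  have fS: "f \<beta> = l \<beta>" if "\<beta> \<in> S" for \<beta>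
  proof -
    have "w j * \<bar>\<beta> $ j\<bar> = 0" for j
      using that w0 by (cases "j \<in> A") (auto simp: S_def)
    then have "(\<Sum>j\<in>UNIV. w j * \<bar>\<beta> $ j\<bar>) = 0" by (intro sum.neutral) blast
    then show ?thesis by (simp add: f_def)
  qed
  have gap: "f b < f \<beta>" if "\<beta> \<noteq> b" for \<beta>
  proof (cases "\<beta> \<in> S")
    case True
    \<comment> \<open>Otherwise \<beta> would be a second minimizer over \<open>S\<close>.\<close>
    have "l b < l \<beta>"
    proof (rule ccontr)
      assume "\<not> l b < l \<beta>"
      then have "is_arg_min l (\<lambda>z. z \<in> S) \<beta>"
        using min[of b] True by (auto simp: is_arg_min_def)
      with min that show False by blast
    qed
    with True bS show ?thesis by (simp add: fS)
  next
    case False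
    then obtain k where k: "k \<notin> A" "\<beta> $ k \<noteq> 0" by (auto simp: S_def)
    \<comment> \<open>Off \<open>A\<close>, \<open>b $ j = 0\<close> and the product
      \<open>g $ j * \<beta> $ j\<close> is at least minus its absolute value; on \<open>A\<close>
      both sides are 0.\<close>
    have ge: "g $ j * (\<beta> $ j - b $ j) + w j * \<bar>\<beta> $ j\<bar> \<ge> (w j - \<bar>g $ j\<bar>) * \<bar>\<beta> $ j\<bar>" for j
    proof (cases "j \<in> A")
      case False
      have "\<bar>g $ j * \<beta> $ j\<bar> = \<bar>g $ j\<bar> * \<bar>\<beta> $ j\<bar>" by (rule abs_mult)
      moreover have "b $ j = 0" using bS False by (auto simp: S_def)
      ultimately show ?thesis by (simp add: algebra_simps)
    qed (simp add: g0 w0)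
    have "0 < (\<Sum>j\<in>UNIV. (w j - \<bar>g $ j\<bar>) * \<bar>\<beta> $ j\<bar>)"
    proof (rule sum_pos2[of _ k])
      show "0 < (w k - \<bar>g $ k\<bar>) * \<bar>\<beta> $ k\<bar>" using k gw[of k] by simp
      show "0 \<le> (w j - \<bar>g $ j\<bar>) * \<bar>\<beta> $ j\<bar>" for j
        using gw[of j] g0[of j] w0[of j] by (cases "j \<in> A") auto
    qed auto
    also have "\<dots> \<le> (\<Sum>j\<in>UNIV. g $ j * (\<beta> $ j - b $ j) + w j * \<bar>\<beta> $ j\<bar>)"
      by (intro sum_mono ge)
    also have "\<dots> = g \<bullet> (\<beta> - b) + (\<Sum>j\<in>UNIV. w j * \<bar>\<beta> $ j\<bar>)"
      by (simp add: inner_vec_def sum.distrib)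
    also have "\<dots> \<le> f \<beta> - l b"
      using subgrad unfolding is_subgradient_def f_def by (simp add: algebra_simps)
    finally show ?thesis by (simp add: fS bS)
  qed
  \<comment> \<open>Strict \<open>gap\<close> gives both halves: nothing lies below
    \<open>b\<close>, and \<open>b\<close> lies below every other point.\<close>
  have "is_arg_min f (\<lambda>z. z \<in> UNIV) y \<longleftrightarrow> y = b" for y
    unfolding is_arg_min_def using gap by (metis UNIV_I less_asym)
  then show ?thesis unfolding is_unique_minimizer_def f_def by auto
qed

theorem theorem1:
  fixes l :: "real ^ 'p \<Rightarrow> real"
    and P :: "real \<Rightarrow> real"
    and beta_star beta_init beta_oracle g :: "real ^ 'p"
    and lam a1 a2 a a0 :: real
  assumes "convex_on UNIV l"
    and "lam > 0"
    and "folded_concave_penalty a1 a2 a lam P"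
    and "is_oracle_estimator l (support beta_star) beta_oracle"
    and "is_subgradient l beta_oracle g"
    and "\<forall>j\<in>support beta_star. g $ j = 0"
    and "min_norm_on (support beta_star) beta_star > ereal ((a + 1) * lam)"
    and "a0 = min 1 a2"
    and "max_norm_on UNIV (beta_init - beta_star) \<le> a0 * lam"
    and "max_norm_on (- support beta_star) g < a1 * lam"
  shows "lla_iterates l P beta_init 1 = {beta_oracle}"
proof -
  define w where "w j = penalty_deriv P \<bar>beta_init $ j\<bar>" for j
  have close: "\<bar>beta_init $ j - beta_star $ j\<bar> \<le> a0 * lam" for j
    using abs_nth_le_max_norm_on[of j UNIV "beta_init - beta_star"] assms(9) by simp
  \<comment> \<open>The minimum serves two purposes: the first bound is used on the support, the
    second off it.\<close>
  have a0: "a0 * lam \<le> lam" "a0 * lam \<le> a2 * lam"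
    using assms(2,8) by (auto intro: mult_right_mono)
  have w0: "w j = 0" if "j \<in> support beta_star" for j
  proof -
    have "ereal ((a + 1) * lam) < ereal \<bar>beta_star $ j\<bar>"
      using assms(7) min_norm_on_le_abs_nth[OF that] by (rule less_le_trans)
    \<comment> \<open>The extra \<open>lam\<close> in the signal strength absorbs the initial error,
      so the coordinate stays where the penalty is flat.\<close>
    then have "a * lam \<le> \<bar>beta_init $ j\<bar>"
      using close[of j] a0(1) by (simp add: algebra_simps)
    then show ?thesis using assms(3) by (simp add: folded_concave_penalty_def w_def)
  qed
  have gw: "\<bar>g $ j\<bar> < w j" if "j \<notin> support beta_star" for j
  proof -
    have "\<bar>g $ j\<bar> < a1 * lam"
      using abs_nth_le_max_norm_on[of j "- support beta_star" g] that assms(10) by simp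
    \<comment> \<open>Since \<open>beta_star $ j = 0\<close>, the initial error is the coordinate
      itself. The chain continues with the lower bound on \<open>w j\<close> derived from
      this.\<close>
    also have "\<bar>beta_init $ j\<bar> \<le> a2 * lam"
      using close[of j] a0(2) that by (simp add: support_def)
    then have "a1 * lam \<le> w j"
      unfolding w_def by (intro penalty_deriv_ge[OF assms(3)]) auto
    finally show ?thesis .
  qed
  have "is_unique_minimizer (\<lambda>\<beta>. l \<beta> + (\<Sum>j\<in>UNIV. w j * \<bar>\<beta> $ j\<bar>)) UNIV beta_oracle"
    using assms(4,5,6) w0 gw by (intro unique_minimizer_weighted_l1) auto
  moreover have "(\<lambda>\<beta>. l \<beta> + (\<Sum>j\<in>UNIV. w j * \<bar>\<beta> $ j\<bar>)) = lla_objective l P beta_init"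
    by (simp add: lla_objective_def w_def fun_eq_iff)
  \<comment> \<open>The zeroth iterate set is a singleton, so the union defining the first is a
    single set of minimizers.\<close>
  ultimately show ?thesis by (simp add: is_unique_minimizer_def)
qed

end
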